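(* Let $G$ be a finite-dimensional Lie group with Lie algebra $\mathfrak g$, let $\mathbb L:G\times G\to\mathbb R$ be a smooth function invariant under the diagonal right action of $G$, let $\ell:G\to\mathbb R$ be given by $\ell(g_1g_2^{-1})=\mathbb L(g_1,g_2)$, and let $\{f_{k\,k+1}\}$ be a sequence in $G$ provided by the discrete Euler-Poincaré (DEP) algorithm on $G$. Then the discrete Lie-Poisson (DLP) algorithm on $\mathfrak g^*$ defined along this sequence by $$\mu_{k+1}=\operatorname{Ad}^*_{f_{k\,k+1}}\cdot\mu_k$$ is Lie-Poisson, i.e. it preserves the $(+)$ Lie-Poisson structure on $\mathfrak g^*$ (for each $k$ the map $\mu_k\mapsto\mu_{k+1}$ is a Poisson map of $\mathfrak g^*$ with the $(+)$ Lie-Poisson bracket).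
   Context: $\operatorname{Ad}^*_f:\mathfrak g^*\to\mathfrak g^*$ is the dual of $\operatorname{Ad}_f$: $\langle\operatorname{Ad}^*_f\mu,\xi\rangle=\langle\mu,\operatorname{Ad}_f\xi\rangle$. The $(+)$ Lie-Poisson structure on $\mathfrak g^*$ is $\{F,H\}^+(\mu)=\left\langle\mu,\left[\frac{\delta F}{\delta\mu},\frac{\delta H}{\delta\mu}\right]\right\rangle$, where $\frac{\delta F}{\delta\mu}\in\mathfrak g$ is the differential of $F$ at $\mu$ under $\mathfrak g^{**}\cong\mathfrak g$. The DEP equations for the sequence are: for each interior index $k$ and all $\vartheta\in\mathfrak g$, $$-\ell'(f_{k-1\,k})\cdot TR_{f_{k-1\,k}}\bigl(\operatorname{Ad}_{f_{k-1\,k}}\vartheta\bigr)+\ell'(f_{k\,k+1})\cdot TR_{f_{k\,k+1}}(\vartheta)=0,$$ where $\ell'$ is the differential of $\ell$ and $TR_f:\mathfrak g\to T_fG$ is the tangent map at $e$ of right translation $R_f(g)=gf$. *)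

theory Defs
  imports "HOL-Analysis.Analysis" "HOL-Algebra.Group"
begin

section \<open>Smooth maps between finite-dimensional normed spaces\<close>

text \<open>
  The model spaces are arbitrary finite-dimensional real normed spaces rather than members of
  \<^class>\<open>euclidean_space\<close>, because the latter have dimension at least 1. On a finite-dimensional
  domain (the only use below), being differentiable with all directional derivatives n times
  differentiable and continuous is the same as being of class C^n.
\<close>

definition finite_dimensional_space :: "'e::real_normed_vector itself \<Rightarrow> bool" where
  "finite_dimensional_space _ \<longleftrightarrow> (\<exists>B::'e set. finite B \<and> span B = UNIV)"

primrec times_differentiable_on ::
  "nat \<Rightarrow> 'a::real_normed_vector set \<Rightarrow> ('a \<Rightarrow> 'b::real_normed_vector) \<Rightarrow> bool" where
  "times_differentiable_on 0 S = (\<lambda>f. continuous_on S f)"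
| "times_differentiable_on (Suc n) S = (\<lambda>f. (\<forall>x\<in>S. f differentiable (at x)) \<and>
     (\<forall>v. times_differentiable_on n S (\<lambda>x. frechet_derivative f (at x) v)))"

definition smooth_on :: "'a::real_normed_vector set \<Rightarrow> ('a \<Rightarrow> 'b::real_normed_vector) \<Rightarrow> bool" where
  "smooth_on S f \<longleftrightarrow> (\<forall>n. times_differentiable_on n S f)"

section \<open>Smooth manifolds\<close>

text \<open>
  A chart is a pair of its domain and its coordinate map; the values of the latter outside the
  domain are irrelevant.
\<close>

type_synonym ('m, 'e) chart = "'m set \<times> ('m \<Rightarrow> 'e)"

abbreviation chart_dom :: "('m, 'e) chart \<Rightarrow> 'm set" where
  "chart_dom \<equiv> fst"

abbreviation coord :: "('m, 'e) chart \<Rightarrow> 'm \<Rightarrow> 'e" where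
  "coord \<equiv> snd"

definition chart_inv :: "('m, 'e) chart \<Rightarrow> 'e \<Rightarrow> 'm" where
  "chart_inv c = inv_into (chart_dom c) (coord c)"

definition is_chart :: "'m topology \<Rightarrow> ('m, 'e::real_normed_vector) chart \<Rightarrow> bool" where
  "is_chart X c \<longleftrightarrow> openin X (chart_dom c) \<and> open (coord c ` chart_dom c) \<and>
     homeomorphic_map (subtopology X (chart_dom c)) (top_of_set (coord c ` chart_dom c)) (coord c)"

locale smooth_manifold =
  fixes X :: "'m topology" and A :: "('m, 'e::real_normed_vector) chart set"
  assumes finite_dimensional: "finite_dimensional_space TYPE('e)"
    and Hausdorff: "Hausdorff_space X"
    and second_countable: "second_countable X"
    and charts: "c \<in> A \<Longrightarrow> is_chart X c"
    and cover: "(\<Union>c\<in>A. chart_dom c) = topspace X"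
    and compatible: "\<lbrakk>c \<in> A; d \<in> A\<rbrakk> \<Longrightarrow>
      smooth_on (coord c ` (chart_dom c \<inter> chart_dom d)) (coord d \<circ> chart_inv c)"

definition smooth_map ::
  "'m topology \<Rightarrow> ('m, 'e::real_normed_vector) chart set \<Rightarrow>
   'n topology \<Rightarrow> ('n, 'f::real_normed_vector) chart set \<Rightarrow> ('m \<Rightarrow> 'n) \<Rightarrow> bool" where
  "smooth_map X A Y B \<phi> \<longleftrightarrow> continuous_map X Y \<phi> \<and>
     (\<forall>c\<in>A. \<forall>d\<in>B. smooth_on (coord c ` {x \<in> chart_dom c. \<phi> x \<in> chart_dom d})
        (coord d \<circ> \<phi> \<circ> chart_inv c))"

definition prod_atlas ::
  "('m, 'e) chart set \<Rightarrow> ('n, 'f) chart set \<Rightarrow> ('m \<times> 'n, 'e \<times> 'f) chart set" where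
  "prod_atlas A B =
     {(chart_dom c \<times> chart_dom d, map_prod (coord c) (coord d)) | c d. c \<in> A \<and> d \<in> B}"

definition real_atlas :: "(real, real) chart set" where
  "real_atlas = {(UNIV, \<lambda>x. x)}"

text \<open>
  Once and for all a preferred chart of the atlas is chosen around each point p, and the tangent
  space at p is the model space, a tangent vector at p being identified with its coordinate vector
  in the preferred chart at p. A vector field is thus a function from points to model vectors
  (in general discontinuous as such, even when the field is smooth).
\<close>

definition chart_at :: "('m, 'e) chart set \<Rightarrow> 'm \<Rightarrow> ('m, 'e) chart" where
  "chart_at A p = (SOME c. c \<in> A \<and> p \<in> chart_dom c)"

definition tangent_map ::
  "('m, 'e::real_normed_vector) chart set \<Rightarrow> ('n, 'f::real_normed_vector) chart set \<Rightarrow>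
   ('m \<Rightarrow> 'n) \<Rightarrow> 'm \<Rightarrow> 'e \<Rightarrow> 'f" where
  "tangent_map A B \<phi> p =
     frechet_derivative (coord (chart_at B (\<phi> p)) \<circ> \<phi> \<circ> chart_inv (chart_at A p))
       (at (coord (chart_at A p) p))"

text \<open>
  The expression of the vector field V in the coordinates of the chart c: at the point q with
  coordinates x, the vector V q is transported from the preferred chart at q to c.
\<close>

definition field_in_chart ::
  "('m, 'e::real_normed_vector) chart set \<Rightarrow> ('m, 'e) chart \<Rightarrow> ('m \<Rightarrow> 'e) \<Rightarrow> 'e \<Rightarrow> 'e" where
  "field_in_chart A c V x =
     (let q = chart_inv c x
      in frechet_derivative (coord c \<circ> chart_inv (chart_at A q))
           (at (coord (chart_at A q) q)) (V q))"

text \<open>The commutator of vector fields, in coordinates DW(V) - DV(W).\<close>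

definition field_bracket ::
  "('m, 'e::real_normed_vector) chart set \<Rightarrow> ('m \<Rightarrow> 'e) \<Rightarrow> ('m \<Rightarrow> 'e) \<Rightarrow> 'm \<Rightarrow> 'e" where
  "field_bracket A V W p =
     (let c = chart_at A p; x = coord c p;
          V' = field_in_chart A c V; W' = field_in_chart A c W
      in frechet_derivative W' (at x) (V' x) - frechet_derivative V' (at x) (W' x))"

section \<open>Lie groups and their Lie algebras\<close>

locale lie_group = Group.group G + smooth_manifold X A
  for G :: "('g, 'x) monoid_scheme" (structure)
    and X :: "'g topology" and A :: "('g, 'e::real_normed_vector) chart set" +
  assumes topspace_eq: "topspace X = carrier G"
    and smooth_mult:
      "smooth_map (prod_topology X X) (prod_atlas A A) X A (\<lambda>(g, h). g \<otimes>\<^bsub>G\<^esub> h)"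
    and smooth_inv: "smooth_map X A X A (m_inv G)"

text \<open>
  The Lie algebra is the tangent space at the identity, hence the model space \<open>'e\<close>, with the
  bracket of left-invariant vector fields. Its dual is the space \<open>'e \<Rightarrow>\<^sub>L real\<close>; on a
  finite-dimensional space every linear functional is bounded.
\<close>

definition left_invariant_field ::
  "('g, 'x) monoid_scheme \<Rightarrow> ('g, 'e::real_normed_vector) chart set \<Rightarrow> 'e \<Rightarrow> 'g \<Rightarrow> 'e" where
  "left_invariant_field G A \<xi> g = tangent_map A A (\<lambda>h. g \<otimes>\<^bsub>G\<^esub> h) \<one>\<^bsub>G\<^esub> \<xi>"

definition lie_bracket ::
  "('g, 'x) monoid_scheme \<Rightarrow> ('g, 'e::real_normed_vector) chart set \<Rightarrow> 'e \<Rightarrow> 'e \<Rightarrow> 'e" where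
  "lie_bracket G A \<xi> \<eta> =
     field_bracket A (left_invariant_field G A \<xi>) (left_invariant_field G A \<eta>) \<one>\<^bsub>G\<^esub>"

definition TR ::
  "('g, 'x) monoid_scheme \<Rightarrow> ('g, 'e::real_normed_vector) chart set \<Rightarrow> 'g \<Rightarrow> 'e \<Rightarrow> 'e" where
  "TR G A f = tangent_map A A (\<lambda>g. g \<otimes>\<^bsub>G\<^esub> f) \<one>\<^bsub>G\<^esub>"

definition Ad ::
  "('g, 'x) monoid_scheme \<Rightarrow> ('g, 'e::real_normed_vector) chart set \<Rightarrow> 'g \<Rightarrow> 'e \<Rightarrow> 'e" where
  "Ad G A f = tangent_map A A (\<lambda>g. f \<otimes>\<^bsub>G\<^esub> g \<otimes>\<^bsub>G\<^esub> m_inv G f) \<one>\<^bsub>G\<^esub>"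

definition Ad_dual ::
  "('g, 'x) monoid_scheme \<Rightarrow> ('g, 'e::real_normed_vector) chart set \<Rightarrow> 'g \<Rightarrow>
   ('e \<Rightarrow>\<^sub>L real) \<Rightarrow> ('e \<Rightarrow>\<^sub>L real)" where
  "Ad_dual G A f \<mu> = Blinfun (\<lambda>\<xi>. blinfun_apply \<mu> (Ad G A f \<xi>))"

section \<open>The Lie-Poisson structure on the dual\<close>

definition functional_derivative ::
  "(('e::real_normed_vector \<Rightarrow>\<^sub>L real) \<Rightarrow> real) \<Rightarrow> ('e \<Rightarrow>\<^sub>L real) \<Rightarrow> 'e" where
  "functional_derivative F \<mu> =
     (THE \<xi>. \<forall>\<nu>. frechet_derivative F (at \<mu>) \<nu> = blinfun_apply \<nu> \<xi>)"

definition lie_poisson_bracket ::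
  "('g, 'x) monoid_scheme \<Rightarrow> ('g, 'e::real_normed_vector) chart set \<Rightarrow>
   (('e \<Rightarrow>\<^sub>L real) \<Rightarrow> real) \<Rightarrow> (('e \<Rightarrow>\<^sub>L real) \<Rightarrow> real) \<Rightarrow> ('e \<Rightarrow>\<^sub>L real) \<Rightarrow> real" where
  "lie_poisson_bracket G A F H \<mu> =
     blinfun_apply \<mu> (lie_bracket G A (functional_derivative F \<mu>) (functional_derivative H \<mu>))"

definition lie_poisson_map ::
  "('g, 'x) monoid_scheme \<Rightarrow> ('g, 'e::real_normed_vector) chart set \<Rightarrow>
   (('e \<Rightarrow>\<^sub>L real) \<Rightarrow> ('e \<Rightarrow>\<^sub>L real)) \<Rightarrow> bool" where
  "lie_poisson_map G A \<psi> \<longleftrightarrow> smooth_on UNIV \<psi> \<and>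
     (\<forall>F H. smooth_on UNIV F \<longrightarrow> smooth_on UNIV H \<longrightarrow>
        lie_poisson_bracket G A (F \<circ> \<psi>) (H \<circ> \<psi>) = lie_poisson_bracket G A F H \<circ> \<psi>)"

section \<open>The discrete Euler-Poincare and Lie-Poisson algorithms\<close>

text \<open>
  A sequence is a function f with \<open>f k\<close> standing for the group element with the double index
  k, k+1, where k < N; it is infinite if N is. The interior indices are those k with both
  \<open>f (k - 1)\<close> and \<open>f k\<close> in the sequence; below, the interior index is \<open>Suc k\<close>.
\<close>

definition dep_sequence ::
  "('g, 'x) monoid_scheme \<Rightarrow> ('g, 'e::real_normed_vector) chart set \<Rightarrow> ('g \<Rightarrow> real) \<Rightarrow>
   enat \<Rightarrow> (nat \<Rightarrow> 'g) \<Rightarrow> bool" where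
  "dep_sequence G A l N f \<longleftrightarrow>
     (\<forall>k. enat k < N \<longrightarrow> f k \<in> carrier G) \<and>
     (\<forall>k \<theta>. enat (Suc k) < N \<longrightarrow>
        - tangent_map A real_atlas l (f k) (TR G A (f k) (Ad G A (f k) \<theta>))
        + tangent_map A real_atlas l (f (Suc k)) (TR G A (f (Suc k)) \<theta>) = 0)"

definition dlp_step ::
  "('g, 'x) monoid_scheme \<Rightarrow> ('g, 'e::real_normed_vector) chart set \<Rightarrow> (nat \<Rightarrow> 'g) \<Rightarrow> nat \<Rightarrow>
   ('e \<Rightarrow>\<^sub>L real) \<Rightarrow> ('e \<Rightarrow>\<^sub>L real)" where
  "dlp_step G A f k \<mu> = Ad_dual G A (f k) \<mu>"

end

theory Submission
  imports Defs
begin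

text \<open>
  Each step of the algorithm is the coadjoint map \<open>Ad_dual\<close> of one group element f, that is, the
  transpose of the linear map T = Ad f on the Lie algebra. Such a transpose pulls functional
  derivatives back by T: the functional derivative of F composed with the step, taken at \<mu>, is
  T applied to the functional derivative of F at the image of \<mu>
  (\<open>functional_derivative_compose_Ad_dual\<close>). The Lie-Poisson bracket of the composed functions at \<mu>
  is therefore \<mu> [T \<xi>, T \<eta>], where \<xi> and \<eta> are the functional derivatives of F and H at
  the image of \<mu>, while the bracket of F and H at that image is \<mu> (T [\<xi>, \<eta>]). So everything
  rests on T being a homomorphism of Lie algebras (\<open>Ad_lie_bracket\<close>).

  That fact holds for the differential of every homomorphism of Lie groups, here the conjugation by
  f. A homomorphism h commutes with left translations in the sense that h (q g) = h q h g, so it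
  relates the left-invariant field of \<xi> to that of Dh \<xi> (\<open>left_invariant_fields_related\<close>), and
  related fields have related commutators (\<open>commutator_of_related_fields\<close>). The latter is a
  computation in one chart around the identity, whose only non-formal ingredient is the symmetry of
  the second derivative (\<open>second_derivative_symmetric\<close>).

  Functional derivatives exist and are unique because a finite-dimensional space is reflexive. The
  model space is an abstract finite-dimensional normed space without a given basis or inner product,
  so this, and the product rule for a field of linear maps applied to a vector field
  (\<open>has_derivative_apply\<close>), are derived from the continuity of coordinates
  (\<open>finite_dimensional_coordinates\<close>).
\<close>

section \<open>Coordinate functionals on finite-dimensional normed spaces\<close>

text \<open>
  If b is at positive distance from a subspace, this inequality bounds the coefficient of b in a
  vector by the norm of that vector. It yields both the completeness of finite-dimensional subspaces
  and the continuity of coordinates.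
\<close>

lemma infdist_span_le:
  fixes b :: "'a::real_normed_vector"
  assumes "v \<in> span S"
  shows "\<bar>t\<bar> * infdist b (span S) \<le> norm (v + t *\<^sub>R b)"
proof (cases "t = 0")
  case False
  have "(- 1 / t) *\<^sub>R v \<in> span S"
    using assms by (rule span_scale)
  then have "infdist b (span S) \<le> norm (b - (- 1 / t) *\<^sub>R v)"
    by (metis dist_norm infdist_le)
  then have "\<bar>t\<bar> * infdist b (span S) \<le> \<bar>t\<bar> * norm (b - (- 1 / t) *\<^sub>R v)"
    by (rule mult_left_mono) simp
  also have "\<dots> = norm (v + t *\<^sub>R b)"
    using False by (simp flip: norm_scaleR add: algebra_simps)
  finally show ?thesis .
qed simp

lemma Cauchy_minus:
  fixes f g :: "nat \<Rightarrow> 'a::real_normed_vector"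
  assumes "Cauchy f" and "Cauchy g"
  shows "Cauchy (\<lambda>n. f n - g n)"
  unfolding Cauchy_def
proof (intro allI impI)
  fix e :: real assume "e > 0"
  then obtain M1 M2 where "\<forall>m\<ge>M1. \<forall>n\<ge>M1. dist (f m) (f n) < e / 2"
    and "\<forall>m\<ge>M2. \<forall>n\<ge>M2. dist (g m) (g n) < e / 2"
    using assms unfolding Cauchy_def by (meson half_gt_zero)
  moreover have "dist (f m - g m) (f n - g n) \<le> dist (f m) (f n) + dist (g m) (g n)" for m n
    using norm_triangle_ineq4[of "f m - f n" "g m - g n"] by (simp add: dist_norm algebra_simps)
  ultimately have "\<forall>m\<ge>max M1 M2. \<forall>n\<ge>max M1 M2. dist (f m - g m) (f n - g n) < e"
    by (smt (verit) field_sum_of_halves max.bounded_iff)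
  then show "\<exists>M. \<forall>m\<ge>M. \<forall>n\<ge>M. dist (f m - g m) (f n - g n) < e" by blast
qed

text \<open>
  A new spanning vector b outside span S has positive distance to it, because a complete subspace is
  closed. The b-coefficients of a Cauchy sequence are then Cauchy themselves and converge in the
  reals, and subtracting the b-part leaves a Cauchy sequence in span S.
\<close>

lemma complete_span_finite:
  fixes S :: "'a::real_normed_vector set"
  assumes "finite S"
  shows "complete (span S)"
  using assms
proof induction
  case empty
  then show ?case by (simp add: compact_imp_complete)
next
  case (insert b S)
  show ?case
  proof (cases "b \<in> span S")
    case True
    then show ?thesis using insert.IH by (simp add: span_redundant)
  next
    case False
    define d where "d = infdist b (span S)"
    have "closed (span S)" using insert.IH by (rule complete_imp_closed)
    then have "d > 0"
      unfolding d_def using False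
      by (metis empty_iff in_closed_iff_infdist_zero infdist_nonneg less_eq_real_def span_zero)
    show ?thesis
    proof (rule completeI)
      fix x :: "nat \<Rightarrow> 'a"
      assume x: "\<forall>n. x n \<in> span (insert b S)" and "Cauchy x"
      have "\<forall>n. \<exists>k. x n - k *\<^sub>R b \<in> span S"
        using x span_breakdown_eq by blast
      then obtain t where t: "\<And>n. x n - t n *\<^sub>R b \<in> span S" by metis
      have bound: "\<bar>t m - t n\<bar> * d \<le> norm (x m - x n)" for m n
      proof -
        have "(x m - t m *\<^sub>R b) - (x n - t n *\<^sub>R b) \<in> span S"
          by (intro span_diff t)
        from infdist_span_le[OF this, of "t m - t n" b] show ?thesis
          by (simp add: d_def algebra_simps)
      qed
      have "Cauchy t"
        unfolding Cauchy_def
      proof (intro allI impI)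
        fix e :: real assume "e > 0"
        then have "e * d > 0" using \<open>d > 0\<close> by simp
        then obtain M where M: "\<forall>m\<ge>M. \<forall>n\<ge>M. dist (x m) (x n) < e * d"
          using \<open>Cauchy x\<close> unfolding Cauchy_def by meson
        have "dist (t m) (t n) < e" if "m \<ge> M" "n \<ge> M" for m n
        proof -
          have "\<bar>t m - t n\<bar> * d < e * d"
            using bound[of m n] M that by (fastforce simp: dist_norm)
          then show ?thesis using \<open>d > 0\<close> by (simp add: dist_real_def)
        qed
        then show "\<exists>M. \<forall>m\<ge>M. \<forall>n\<ge>M. dist (t m) (t n) < e" by blast
      qed
      then obtain t0 where t0: "t \<longlonglongrightarrow> t0"
        using convergent_def real_Cauchy_convergent by blast
      have "(\<lambda>n. t n *\<^sub>R b) \<longlonglongrightarrow> t0 *\<^sub>R b"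
        by (intro tendsto_intros t0)
      then have "Cauchy (\<lambda>n. x n - t n *\<^sub>R b)"
        by (rule Cauchy_minus[OF \<open>Cauchy x\<close> LIMSEQ_imp_Cauchy])
      then have "\<exists>v\<in>span S. (\<lambda>n. x n - t n *\<^sub>R b) \<longlonglongrightarrow> v"
        using insert.IH[unfolded complete_def, rule_format, of "\<lambda>n. x n - t n *\<^sub>R b"] t by simp
      then obtain v where v: "v \<in> span S" "(\<lambda>n. x n - t n *\<^sub>R b) \<longlonglongrightarrow> v" ..
      have "(\<lambda>n. (x n - t n *\<^sub>R b) + t n *\<^sub>R b) \<longlonglongrightarrow> v + t0 *\<^sub>R b"
        by (intro tendsto_intros t0 v)
      then have "x \<longlonglongrightarrow> v + t0 *\<^sub>R b" by simp
      moreover have "v + t0 *\<^sub>R b \<in> span (insert b S)"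
        using v(1) by (metis add_diff_cancel_right' span_breakdown_eq)
      ultimately show "\<exists>l\<in>span (insert b S). x \<longlonglongrightarrow> l" by blast
    qed
  qed
qed

text \<open>
  Coordinates with respect to a basis are continuous: each basis vector is at positive distance from
  the span of the others. This one fact gives everything that finite dimension is used for: a field of
  linear maps can be differentiated through its values on basis vectors, the dual space separates
  points, and every functional on the dual is the evaluation at a vector.
\<close>

lemma finite_dimensional_coordinates:
  assumes "finite_dimensional_space TYPE('e::real_normed_vector)"
  obtains B :: "'e::real_normed_vector set" and c :: "'e::real_normed_vector \<Rightarrow> ('e::real_normed_vector \<Rightarrow>\<^sub>L real)"
  where "finite B" and "\<And>x. (\<Sum>b\<in>B. blinfun_apply (c b) x *\<^sub>R b) = x"
proof -
  from assms obtain B0 :: "'e set" where B0: "finite B0" "span B0 = UNIV"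
    unfolding finite_dimensional_space_def by blast
  obtain B where B: "B \<subseteq> B0" "independent B" "B0 \<subseteq> span B"
    using maximal_independent_subset by blast
  have fin: "finite B" using B(1) B0(1) finite_subset by blast
  have spB: "span B = UNIV"
    using B(3) B0(2) by (metis span_mono span_span top.extremum_unique)
  have sum_rep: "(\<Sum>b\<in>B. representation B x b *\<^sub>R b) = x" for x
    using real_vector.sum_representation_eq[OF B(2), of x B] spB fin by simp
  have bl: "bounded_linear (\<lambda>x. representation B x b)" if b: "b \<in> B" for b
  proof -
    define d where "d = infdist b (span (B - {b}))"
    have "b \<notin> span (B - {b})" using B(2) b unfolding dependent_def by blast
    moreover have "closed (span (B - {b}))"
      using fin by (intro complete_imp_closed complete_span_finite) simp
    ultimately have "d > 0"
      unfolding d_def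
      by (metis empty_iff in_closed_iff_infdist_zero infdist_nonneg less_eq_real_def span_zero)
    show ?thesis
    proof (rule bounded_linear_intro)
      fix x y :: 'e and r :: real
      show "representation B (x + y) b = representation B x b + representation B y b"
        by (simp add: real_vector.representation_add[OF B(2)] spB)
      show "representation B (r *\<^sub>R x) b = r *\<^sub>R representation B x b"
        by (simp add: real_vector.representation_scale[OF B(2)] spB)
      have "x = (\<Sum>a\<in>B - {b}. representation B x a *\<^sub>R a) + representation B x b *\<^sub>R b"
        using sum_rep[of x] fin b by (simp add: sum.remove add.commute)
      moreover have "(\<Sum>a\<in>B - {b}. representation B x a *\<^sub>R a) \<in> span (B - {b})"
        by (intro span_sum span_scale span_base)
      ultimately have "\<bar>representation B x b\<bar> * d \<le> norm x"
        unfolding d_def by (metis infdist_span_le)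
      then show "norm (representation B x b) \<le> norm x * (1 / d)"
        using \<open>d > 0\<close> by (simp add: field_simps)
    qed
  qed
  show ?thesis
  proof (rule that[of B "\<lambda>b. Blinfun (\<lambda>x. representation B x b)"])
    show "(\<Sum>b\<in>B. blinfun_apply (Blinfun (\<lambda>x. representation B x b)) x *\<^sub>R b) = x" for x
      using sum_rep[of x] by (simp add: bounded_linear_Blinfun_apply bl cong: sum.cong)
  qed (rule fin)
qed

lemma finite_dimensional_space_prod:
  assumes "finite_dimensional_space TYPE('a::real_normed_vector)"
    and "finite_dimensional_space TYPE('b::real_normed_vector)"
  shows "finite_dimensional_space TYPE('a \<times> 'b)"
proof -
  obtain B :: "'a set" and C :: "'b set"
    where B: "finite B" "span B = UNIV" and C: "finite C" "span C = UNIV"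
    using assms unfolding finite_dimensional_space_def by blast
  let ?D = "(\<lambda>x. (x, 0)) ` B \<union> (\<lambda>y. (0, y)) ` C :: ('a \<times> 'b) set"
  have lin: "linear (\<lambda>x. (x, 0) :: 'a \<times> 'b)" "linear (\<lambda>y. (0, y) :: 'a \<times> 'b)"
    by (auto intro!: linearI)
  have "(x, y) \<in> span ?D" for x y
  proof -
    have "(x, 0) \<in> span ((\<lambda>x. (x, 0) :: 'a \<times> 'b) ` B)"
        "(0, y) \<in> span ((\<lambda>y. (0, y) :: 'a \<times> 'b) ` C)"
      using linear_span_image[OF lin(1), of B] linear_span_image[OF lin(2), of C] B C by auto
    then have "(x, 0) \<in> span ?D" "(0, y) \<in> span ?D"
      by (meson span_mono subsetD sup_ge1 sup_ge2)+
    then have "(x, 0) + (0, y) \<in> span ?D" by (rule span_add)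
    then show ?thesis by simp
  qed
  then have "span ?D = UNIV" by auto
  moreover have "finite ?D" using B(1) C(1) by simp
  ultimately show ?thesis
    unfolding finite_dimensional_space_def by blast
qed

section \<open>Maps that are twice differentiable at a point\<close>

text \<open>
  Coordinate expressions agree with one another only near the point in question, so derivatives are
  handled throughout as properties of germs.
\<close>

lemma has_derivative_eventually_cong:
  assumes "\<forall>\<^sub>F y in nhds x. f y = g y"
  shows "(f has_derivative D) (at x) \<longleftrightarrow> (g has_derivative D) (at x)"
proof -
  have "(g has_derivative D) (at x)"
    if "(f has_derivative D) (at x)" "\<forall>\<^sub>F y in nhds x. f y = g y" for f g
    by (rule has_derivative_transform_eventually[OF that(1)])
       (use that(2) in \<open>auto simp: eventually_at_filter elim: eventually_mono
          dest: eventually_nhds_x_imp_x\<close>)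
  from this[of f g] this[of g f] assms show ?thesis
    by (auto simp: eq_commute)
qed

lemma differentiable_eventually_cong:
  assumes "\<forall>\<^sub>F y in nhds x. f y = g y"
  shows "f differentiable (at x) \<longleftrightarrow> g differentiable (at x)"
  using has_derivative_eventually_cong[OF assms] unfolding differentiable_def by simp

lemma frechet_derivative_eventually_cong:
  assumes "\<forall>\<^sub>F y in nhds x. f y = g y"
  shows "frechet_derivative f (at x) = frechet_derivative g (at x)"
  using has_derivative_eventually_cong[OF assms] unfolding frechet_derivative_def by simp

lemma has_derivative_frechet:
  "f differentiable (at x) \<Longrightarrow> (f has_derivative frechet_derivative f (at x)) (at x)"
  by (simp add: frechet_derivative_works)

lemma frechet_derivative_eqI:
  "(f has_derivative D) (at x) \<Longrightarrow> frechet_derivative f (at x) = D"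
  using frechet_derivative_at by metis

lemma eventually_nhds_compose_continuous:
  assumes "isCont f x" and "\<forall>\<^sub>F y in nhds (f x). P y"
  shows "\<forall>\<^sub>F z in nhds x. P (f z)"
  using assms unfolding isCont_def tendsto_at_iff_tendsto_nhds by (auto simp: filterlim_iff)

text \<open>
  The product rule for applying a field of linear maps to a field of vectors. Expanding V x in
  coordinates turns T x (V x) into a finite sum of products, so that differentiability of
  x \<mapsto> T x b for each fixed vector b is enough.
\<close>

lemma has_derivative_apply:
  fixes T :: "'c::real_normed_vector \<Rightarrow> 'a::real_normed_vector \<Rightarrow> 'b::real_normed_vector"
  assumes fd: "finite_dimensional_space TYPE('a)"
    and lin: "\<forall>\<^sub>F x in nhds x0. linear (T x)"
    and T: "\<And>b. ((\<lambda>x. T x b) has_derivative T' b) (at x0)"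
    and V: "(V has_derivative V') (at x0)"
  shows "((\<lambda>x. T x (V x)) has_derivative (\<lambda>h. T' (V x0) h + T x0 (V' h))) (at x0)"
proof -
  obtain B :: "'a set" and c :: "'a \<Rightarrow> ('a \<Rightarrow>\<^sub>L real)"
    where c: "finite B" "\<And>x. (\<Sum>b\<in>B. blinfun_apply (c b) x *\<^sub>R b) = x"
    using finite_dimensional_coordinates[OF fd] by metis
  have expand: "T x v = (\<Sum>b\<in>B. blinfun_apply (c b) v *\<^sub>R T x b)" if "linear (T x)" for x v
  proof -
    have "T x v = T x (\<Sum>b\<in>B. blinfun_apply (c b) v *\<^sub>R b)" by (simp only: c(2))
    then show ?thesis by (simp add: linear_sum[OF that] linear_scale[OF that])
  qed
  have lin0: "linear (T x0)" using lin by (rule eventually_nhds_x_imp_x)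
  have "((\<lambda>x. \<Sum>b\<in>B. blinfun_apply (c b) (V x0) *\<^sub>R T x b) has_derivative
      (\<lambda>h. \<Sum>b\<in>B. blinfun_apply (c b) (V x0) *\<^sub>R T' b h)) (at x0)"
    by (intro derivative_intros T)
  moreover have "\<forall>\<^sub>F x in nhds x0. (\<Sum>b\<in>B. blinfun_apply (c b) (V x0) *\<^sub>R T x b) = T x (V x0)"
    using lin by eventually_elim (rule expand[symmetric])
  ultimately have "((\<lambda>x. T x (V x0)) has_derivative
      (\<lambda>h. \<Sum>b\<in>B. blinfun_apply (c b) (V x0) *\<^sub>R T' b h)) (at x0)"
    by (rule has_derivative_eventually_cong[THEN iffD1, rotated])
  then have T'V: "T' (V x0) = (\<lambda>h. \<Sum>b\<in>B. blinfun_apply (c b) (V x0) *\<^sub>R T' b h)"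
    by (rule has_derivative_unique[OF T])
  have "((\<lambda>x. \<Sum>b\<in>B. blinfun_apply (c b) (V x) *\<^sub>R T x b) has_derivative
      (\<lambda>h. \<Sum>b\<in>B. blinfun_apply (c b) (V x0) *\<^sub>R T' b h + blinfun_apply (c b) (V' h) *\<^sub>R T x0 b))
      (at x0)"
    by (intro derivative_intros T bounded_linear.has_derivative[OF blinfun.bounded_linear_right V])
  also have "(\<lambda>h. \<Sum>b\<in>B. blinfun_apply (c b) (V x0) *\<^sub>R T' b h
        + blinfun_apply (c b) (V' h) *\<^sub>R T x0 b) = (\<lambda>h. T' (V x0) h + T x0 (V' h))"
    by (simp add: T'V sum.distrib expand[OF lin0, of "V' _"])
  finally have "((\<lambda>x. \<Sum>b\<in>B. blinfun_apply (c b) (V x) *\<^sub>R T x b) has_derivative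
      (\<lambda>h. T' (V x0) h + T x0 (V' h))) (at x0)" .
  moreover have "\<forall>\<^sub>F x in nhds x0. (\<Sum>b\<in>B. blinfun_apply (c b) (V x) *\<^sub>R T x b) = T x (V x)"
    using lin by eventually_elim (rule expand[symmetric])
  ultimately show ?thesis
    by (rule has_derivative_eventually_cong[THEN iffD1, rotated])
qed

text \<open>
  A pointwise notion rather than one on an open set: it depends on the germ of f only, it follows
  from smoothness, and it suffices for the symmetry of the second derivative at x.
\<close>

definition twice_differentiable_at ::
  "('a::real_normed_vector \<Rightarrow> 'b::real_normed_vector) \<Rightarrow> 'a \<Rightarrow> bool" where
  "twice_differentiable_at f x \<longleftrightarrow> (\<forall>\<^sub>F y in nhds x. f differentiable (at y)) \<and>
     (\<forall>v. (\<lambda>y. frechet_derivative f (at y) v) differentiable (at x))"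

lemma twice_differentiable_atD:
  assumes "twice_differentiable_at f x"
  shows "\<forall>\<^sub>F y in nhds x. f differentiable (at y)"
    and "f differentiable (at x)"
    and "(\<lambda>y. frechet_derivative f (at y) v) differentiable (at x)"
    and "isCont f x"
  using assms eventually_nhds_x_imp_x differentiable_imp_continuous_within
  unfolding twice_differentiable_at_def by blast+

lemma twice_differentiable_at_eventually_cong:
  assumes "\<forall>\<^sub>F y in nhds x. f y = g y"
  shows "twice_differentiable_at f x \<longleftrightarrow> twice_differentiable_at g x"
proof -
  have ev: "\<forall>\<^sub>F y in nhds x. \<forall>\<^sub>F z in nhds y. f z = g z"
    using assms by (simp add: eventually_eventually)
  have "(\<forall>\<^sub>F y in nhds x. f differentiable (at y)) \<longleftrightarrow> (\<forall>\<^sub>F y in nhds x. g differentiable (at y))"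
    by (rule eventually_subst, use ev in eventually_elim) (rule differentiable_eventually_cong)
  moreover have "(\<lambda>y. frechet_derivative f (at y) v) differentiable (at x) \<longleftrightarrow>
      (\<lambda>y. frechet_derivative g (at y) v) differentiable (at x)" for v
    by (rule differentiable_eventually_cong, use ev in eventually_elim)
       (simp add: frechet_derivative_eventually_cong)
  ultimately show ?thesis
    unfolding twice_differentiable_at_def by simp
qed

lemma smooth_on_imp_twice_differentiable_at:
  assumes "smooth_on S f" and "open S" and "x \<in> S"
  shows "twice_differentiable_at f x"
proof -
  have "times_differentiable_on (Suc (Suc 0)) S f"
    using assms(1) unfolding smooth_on_def by blast
  then have "\<forall>y\<in>S. f differentiable (at y)"
      "\<And>v. \<forall>y\<in>S. (\<lambda>y. frechet_derivative f (at y) v) differentiable (at y)"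
    by auto
  then show ?thesis
    unfolding twice_differentiable_at_def
    using assms(2,3) eventually_nhds_in_open eventually_mono by (smt (verit))
qed

lemma twice_differentiable_at_affine:
  assumes "\<And>y. (f has_derivative D) (at y)"
  shows "twice_differentiable_at f x"
  using differentiableI[OF assms] frechet_derivative_eqI[OF assms]
  unfolding twice_differentiable_at_def by simp

lemma twice_differentiable_at_compose:
  fixes f :: "'a::real_normed_vector \<Rightarrow> 'b::real_normed_vector"
    and g :: "'b \<Rightarrow> 'c::real_normed_vector"
  assumes fd: "finite_dimensional_space TYPE('b)"
    and f: "twice_differentiable_at f x" and g: "twice_differentiable_at g (f x)"
  shows "twice_differentiable_at (g \<circ> f) x"
proof -
  have cont: "isCont f x" by (rule twice_differentiable_atD(4)[OF f])
  have g_diff: "\<forall>\<^sub>F y in nhds x. g differentiable (at (f y))"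
    using cont twice_differentiable_atD(1)[OF g] by (rule eventually_nhds_compose_continuous)
  have "\<forall>\<^sub>F y in nhds x. (g \<circ> f) differentiable (at y)"
    using g_diff twice_differentiable_atD(1)[OF f]
    by eventually_elim (simp add: differentiable_chain_at)
  moreover have "(\<lambda>y. frechet_derivative (g \<circ> f) (at y) v) differentiable (at x)" for v
  proof -
    have chain: "((\<lambda>y. frechet_derivative g (at (f y)) b) has_derivative
        frechet_derivative (\<lambda>z. frechet_derivative g (at z) b) (at (f x)) \<circ> frechet_derivative f (at x)) (at x)"
      for b
      using diff_chain_at[OF has_derivative_frechet[OF twice_differentiable_atD(2)[OF f]]
          has_derivative_frechet[OF twice_differentiable_atD(3)[OF g, of b]]]
      by (simp add: o_def)
    have lin: "\<forall>\<^sub>F y in nhds x. linear (frechet_derivative g (at (f y)))"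
      using g_diff by eventually_elim (rule linear_frechet_derivative)
    have "(\<lambda>y. frechet_derivative g (at (f y)) (frechet_derivative f (at y) v)) differentiable (at x)"
      by (rule differentiableI[OF has_derivative_apply[OF fd lin chain
              has_derivative_frechet[OF twice_differentiable_atD(3)[OF f]]]])
    moreover have "\<forall>\<^sub>F y in nhds x. frechet_derivative g (at (f y)) (frechet_derivative f (at y) v)
        = frechet_derivative (g \<circ> f) (at y) v"
      using g_diff twice_differentiable_atD(1)[OF f]
      by eventually_elim (simp add: frechet_derivative_compose)
    ultimately show ?thesis
      by (rule differentiable_eventually_cong[THEN iffD1, rotated])
  qed
  ultimately show ?thesis unfolding twice_differentiable_at_def by blast
qed

section \<open>Symmetry of the second derivative\<close>

text \<open>
  The second difference of f along u and v equals t^2 times the second derivative up to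
  o(t^2). Write it as the increment, for s from 0 to 1, of
  f (x + t u + s t v) - f (x + s t v). The s-derivative of this expression is t times the difference
  of the directional derivative of f along v at two points that are t u apart and both within O(t)
  of x, so it is t^2 D u up to o(t^2) uniformly in s, and the mean value inequality
  applies.
\<close>

lemma second_difference_bound:
  fixes f :: "'a::real_normed_vector \<Rightarrow> 'b::real_normed_vector"
  assumes diff: "\<forall>\<^sub>F y in nhds x. f differentiable (at y)"
    and D: "((\<lambda>y. frechet_derivative f (at y) v) has_derivative D) (at x)"
    and "e > 0"
  shows "\<forall>\<^sub>F t in at_right 0.
    norm (f (x + t *\<^sub>R u + t *\<^sub>R v) - f (x + t *\<^sub>R u) - f (x + t *\<^sub>R v) + f x - t\<^sup>2 *\<^sub>R D u) \<le> e * t\<^sup>2"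
proof -
  define \<psi> where "\<psi> y = frechet_derivative f (at y) v" for y
  \<comment> \<open>The points that occur lie within t (norm u + norm v) < t K of x; the factor 2 is there because
    two of them contribute an error, and the summand 1 because u and v may vanish.\<close>
  define K where "K = 2 * (norm u + norm v) + 1"
  have "K > 0" unfolding K_def by (simp add: add_nonneg_pos)
  interpret D: bounded_linear D using D by (rule has_derivative_bounded_linear)
  have "e / K > 0" using \<open>e > 0\<close> \<open>K > 0\<close> by simp
  then obtain d1 where d1: "d1 > 0"
    "\<And>y. norm (y - x) < d1 \<Longrightarrow> norm (\<psi> y - \<psi> x - D (y - x)) \<le> e / K * norm (y - x)"
    using D unfolding has_derivative_at_alt \<psi>_def[symmetric] by meson
  obtain d2 where d2: "d2 > 0" "\<And>y. norm (y - x) < d2 \<Longrightarrow> f differentiable (at y)"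
    using diff unfolding eventually_nhds_metric dist_norm by meson
  define d where "d = min d1 d2 / K"
  have "d > 0" unfolding d_def using d1(1) d2(1) \<open>K > 0\<close> by simp
  have "norm (f (x + t *\<^sub>R u + t *\<^sub>R v) - f (x + t *\<^sub>R u) - f (x + t *\<^sub>R v) + f x - t\<^sup>2 *\<^sub>R D u) \<le> e * t\<^sup>2"
    if t: "0 < t" "t < d" for t
  proof -
    \<comment> \<open>Subtracting the linear term s t^2 D u makes the increment of g the quantity to be bounded.\<close>
    define g where "g s = f (x + t *\<^sub>R u + s *\<^sub>R t *\<^sub>R v) - f (x + s *\<^sub>R t *\<^sub>R v) - s *\<^sub>R t\<^sup>2 *\<^sub>R D u" for s :: real
    define g' where "g' s = t *\<^sub>R (\<psi> (x + t *\<^sub>R u + s *\<^sub>R t *\<^sub>R v) - \<psi> (x + s *\<^sub>R t *\<^sub>R v) - t *\<^sub>R D u)" for s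
    have tK: "t * K < min d1 d2"
      using t(2) \<open>K > 0\<close> unfolding d_def by (simp add: pos_less_divide_eq)
    have near: "norm (r *\<^sub>R t *\<^sub>R u + s *\<^sub>R t *\<^sub>R v) \<le> t * (norm u + norm v)"
      if "r \<in> {0..1}" "s \<in> {0..1}" for r s
    proof -
      have "norm (r *\<^sub>R t *\<^sub>R u + s *\<^sub>R t *\<^sub>R v) \<le> r * (t * norm u) + s * (t * norm v)"
        using norm_triangle_ineq[of "r *\<^sub>R t *\<^sub>R u" "s *\<^sub>R t *\<^sub>R v"] that t by simp
      also have "\<dots> \<le> 1 * (t * norm u) + 1 * (t * norm v)"
        using that t by (intro add_mono mult_right_mono) auto
      finally show ?thesis by (simp add: algebra_simps)
    qed
    have le_tK: "t * (norm u + norm v) < t * K"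
      using t unfolding K_def by (intro mult_strict_left_mono) (simp_all add: add_nonneg_pos)
    have near': "norm (r *\<^sub>R t *\<^sub>R u + s *\<^sub>R t *\<^sub>R v) < min d1 d2"
      if "r \<in> {0..1}" "s \<in> {0..1}" for r s
      using near[OF that] le_tK tK by linarith
    have deriv: "(g has_vector_derivative g' s) (at s within {0..1})" if s: "s \<in> {0..1}" for s
    proof -
      have chain: "((\<lambda>s. f (y + s *\<^sub>R t *\<^sub>R v)) has_vector_derivative t *\<^sub>R \<psi> (y + s *\<^sub>R t *\<^sub>R v)) (at s within {0..1})"
        if "f differentiable (at (y + s *\<^sub>R t *\<^sub>R v))" for y
      proof -
        have lin: "linear (frechet_derivative f (at (y + s *\<^sub>R t *\<^sub>R v)))"
          using that by (rule linear_frechet_derivative)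
        have "((\<lambda>s. y + s *\<^sub>R t *\<^sub>R v) has_derivative (\<lambda>h. h *\<^sub>R t *\<^sub>R v)) (at s within {0..1})"
          by (auto intro!: derivative_eq_intros)
        from has_derivative_compose[OF this has_derivative_frechet[OF that]]
        show ?thesis
          unfolding has_vector_derivative_def \<psi>_def by (simp only: linear_scale[OF lin])
      qed
      have "f differentiable (at (x + t *\<^sub>R u + s *\<^sub>R t *\<^sub>R v))"
        using d2(2)[of "x + t *\<^sub>R u + s *\<^sub>R t *\<^sub>R v"] near'[of 1 s] s by (simp add: algebra_simps)
      moreover have "f differentiable (at (x + s *\<^sub>R t *\<^sub>R v))"
        using d2(2)[of "x + s *\<^sub>R t *\<^sub>R v"] near'[of 0 s] s by simp
      moreover have "((\<lambda>s. s *\<^sub>R t\<^sup>2 *\<^sub>R D u) has_vector_derivative t\<^sup>2 *\<^sub>R D u) (at s within {0..1})"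
        unfolding has_vector_derivative_def by (auto intro!: derivative_eq_intros)
      ultimately have "(g has_vector_derivative t *\<^sub>R \<psi> (x + t *\<^sub>R u + s *\<^sub>R t *\<^sub>R v) - t *\<^sub>R \<psi> (x + s *\<^sub>R t *\<^sub>R v) - t\<^sup>2 *\<^sub>R D u) (at s within {0..1})"
        unfolding g_def by (intro has_vector_derivative_diff chain)
      then show ?thesis
        unfolding g'_def by (simp add: algebra_simps power2_eq_square)
    qed
    have g'_bound: "norm (g' s) \<le> e * t\<^sup>2" if s: "s \<in> {0..1}" for s
    proof -
      define a where "a = t *\<^sub>R u + s *\<^sub>R t *\<^sub>R v"
      define b where "b = s *\<^sub>R t *\<^sub>R v"
      have na: "norm a \<le> t * (norm u + norm v)" "norm a < d1"
        using near[of 1 s] near'[of 1 s] s by (auto simp: a_def)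
      have nb: "norm b \<le> t * (norm u + norm v)" "norm b < d1"
        using near[of 0 s] near'[of 0 s] s by (auto simp: b_def)
      have "D a - D b = t *\<^sub>R D u" by (simp add: a_def b_def D.add D.scaleR)
      then have "\<psi> (x + a) - \<psi> (x + b) - t *\<^sub>R D u
          = (\<psi> (x + a) - \<psi> x - D a) - (\<psi> (x + b) - \<psi> x - D b)"
        by (simp add: algebra_simps)
      then have "norm (\<psi> (x + a) - \<psi> (x + b) - t *\<^sub>R D u)
          \<le> norm (\<psi> (x + a) - \<psi> x - D a) + norm (\<psi> (x + b) - \<psi> x - D b)"
        by (simp only: norm_triangle_ineq4)
      also have "\<dots> \<le> e / K * norm a + e / K * norm b"
        using d1(2)[of "x + a"] d1(2)[of "x + b"] na nb by (intro add_mono) auto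
      also have "\<dots> \<le> e / K * (t * (norm u + norm v)) + e / K * (t * (norm u + norm v))"
        using na nb \<open>e / K > 0\<close> by (intro add_mono mult_left_mono) auto
      also have "\<dots> = e / K * (t * (2 * (norm u + norm v)))" by simp
      also have "\<dots> \<le> e / K * (t * K)"
        using \<open>e / K > 0\<close> t(1) by (intro mult_left_mono) (auto simp: K_def)
      also have "\<dots> = e * t" using \<open>K > 0\<close> by simp
      finally have "t * norm (\<psi> (x + a) - \<psi> (x + b) - t *\<^sub>R D u) \<le> t * (e * t)"
        using t(1) by simp
      moreover have "norm (g' s) = t * norm (\<psi> (x + a) - \<psi> (x + b) - t *\<^sub>R D u)"
        unfolding g'_def a_def b_def using t(1) by (simp add: add.assoc)
      ultimately show ?thesis by (simp add: power2_eq_square algebra_simps)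
    qed
    have "norm (g 1 - g 0) \<le> e * t\<^sup>2 * norm (1 - 0 :: real)"
    proof (rule differentiable_bound[where S = "{0..1}" and f' = "\<lambda>s h. h *\<^sub>R g' s"])
      show "onorm (\<lambda>h. h *\<^sub>R g' s) \<le> e * t\<^sup>2" if "s \<in> {0..1}" for s
        using g'_bound[OF that] by (intro onorm_le) (simp add: mult.commute mult_left_mono)
    qed (use deriv in \<open>auto simp: has_vector_derivative_def\<close>)
    then show ?thesis unfolding g_def by (simp add: algebra_simps)
  qed
  then show ?thesis
    using \<open>d > 0\<close> unfolding eventually_at_right_field by blast
qed

text \<open>
  The second difference does not change when u and v are exchanged, and both mixed derivatives are
  its limit after division by t^2.
\<close>

lemma second_derivative_symmetric:
  fixes f :: "'a::real_normed_vector \<Rightarrow> 'b::real_normed_vector"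
  assumes "twice_differentiable_at f x"
  shows "frechet_derivative (\<lambda>y. frechet_derivative f (at y) v) (at x) u
       = frechet_derivative (\<lambda>y. frechet_derivative f (at y) u) (at x) v"
    (is "?l = ?r")
proof -
  have ub: "norm (?l - ?r) \<le> 2 * e" if "e > 0" for e
  proof -
    let ?d = "\<lambda>t. f (x + t *\<^sub>R u + t *\<^sub>R v) - f (x + t *\<^sub>R u) - f (x + t *\<^sub>R v) + f x"
    have "\<forall>\<^sub>F t in at_right 0. norm (?d t - t\<^sup>2 *\<^sub>R ?l) \<le> e * t\<^sup>2"
      by (rule second_difference_bound[OF twice_differentiable_atD(1)[OF assms]
            has_derivative_frechet[OF twice_differentiable_atD(3)[OF assms]] that])
    moreover have "\<forall>\<^sub>F t in at_right 0. norm (f (x + t *\<^sub>R v + t *\<^sub>R u) - f (x + t *\<^sub>R v) - f (x + t *\<^sub>R u) + f x - t\<^sup>2 *\<^sub>R ?r) \<le> e * t\<^sup>2"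
      by (rule second_difference_bound[OF twice_differentiable_atD(1)[OF assms]
            has_derivative_frechet[OF twice_differentiable_atD(3)[OF assms]] that])
    moreover have "\<forall>\<^sub>F t :: real in at_right 0. t > 0"
      by (rule eventually_at_right_less)
    ultimately have "\<forall>\<^sub>F t in at_right (0::real). norm (?l - ?r) \<le> 2 * e"
    proof eventually_elim
      case (elim t)
      have swap: "f (x + t *\<^sub>R v + t *\<^sub>R u) - f (x + t *\<^sub>R v) - f (x + t *\<^sub>R u) + f x = ?d t"
        by (simp add: add.assoc add.commute[of "t *\<^sub>R v"])
      have "norm ((?d t - t\<^sup>2 *\<^sub>R ?r) - (?d t - t\<^sup>2 *\<^sub>R ?l)) \<le> e * t\<^sup>2 + e * t\<^sup>2"
        by (rule norm_triangle_le_diff[OF add_mono[OF elim(2)[unfolded swap] elim(1)]])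
      also have "(?d t - t\<^sup>2 *\<^sub>R ?r) - (?d t - t\<^sup>2 *\<^sub>R ?l) = t\<^sup>2 *\<^sub>R (?l - ?r)"
        by (simp add: algebra_simps)
      finally have "t\<^sup>2 * norm (?l - ?r) \<le> t\<^sup>2 * (2 * e)" by (simp add: mult.commute)
      then show ?case using elim by simp
    qed
    then show ?thesis by (simp add: eventually_const trivial_limit_at_right_real)
  qed
  have "norm (?l - ?r) \<le> 0"
    by (rule field_le_epsilon) (use ub[of "_ / 2"] in auto)
  then show ?thesis by simp
qed

text \<open>
  Differentiating the relation D\<phi>(y) (V y) = V' (\<phi> y) along W gives the second derivative
  D^2\<phi>(V, W) in addition to the first-order terms; doing the same with V and W exchanged
  and subtracting, the second derivatives cancel by symmetry.
\<close>

lemma commutator_of_related_fields: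
  fixes \<phi> :: "'a::real_normed_vector \<Rightarrow> 'b::real_normed_vector"
  assumes fd: "finite_dimensional_space TYPE('a)"
    and \<phi>: "twice_differentiable_at \<phi> x"
    and V: "V differentiable (at x)" and W: "W differentiable (at x)"
    and V': "V' differentiable (at (\<phi> x))" and W': "W' differentiable (at (\<phi> x))"
    and relV: "\<forall>\<^sub>F y in nhds x. frechet_derivative \<phi> (at y) (V y) = V' (\<phi> y)"
    and relW: "\<forall>\<^sub>F y in nhds x. frechet_derivative \<phi> (at y) (W y) = W' (\<phi> y)"
  shows "frechet_derivative \<phi> (at x)
      (frechet_derivative W (at x) (V x) - frechet_derivative V (at x) (W x))
    = frechet_derivative W' (at (\<phi> x)) (V' (\<phi> x)) - frechet_derivative V' (at (\<phi> x)) (W' (\<phi> x))"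
proof -
  let ?D = "frechet_derivative \<phi> (at x)"
  let ?H = "\<lambda>v. frechet_derivative (\<lambda>y. frechet_derivative \<phi> (at y) v) (at x)"
  have lin: "\<forall>\<^sub>F y in nhds x. linear (frechet_derivative \<phi> (at y))"
    using twice_differentiable_atD(1)[OF \<phi>] by eventually_elim (rule linear_frechet_derivative)
  have deriv: "?H (U x) h + ?D (frechet_derivative U (at x) h)
      = frechet_derivative U' (at (\<phi> x)) (?D h)"
    if U: "U differentiable (at x)" and U': "U' differentiable (at (\<phi> x))"
      and rel: "\<forall>\<^sub>F y in nhds x. frechet_derivative \<phi> (at y) (U y) = U' (\<phi> y)"
    for U U' h
  proof -
    have "((\<lambda>y. frechet_derivative \<phi> (at y) (U y)) has_derivative
        (\<lambda>h. ?H (U x) h + ?D (frechet_derivative U (at x) h))) (at x)"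
      by (rule has_derivative_apply[OF fd lin has_derivative_frechet[OF twice_differentiable_atD(3)[OF \<phi>]]
            has_derivative_frechet[OF U]])
    then have "((\<lambda>y. U' (\<phi> y)) has_derivative
        (\<lambda>h. ?H (U x) h + ?D (frechet_derivative U (at x) h))) (at x)"
      by (rule has_derivative_eventually_cong[OF rel, THEN iffD1])
    moreover have "((\<lambda>y. U' (\<phi> y)) has_derivative (\<lambda>h. frechet_derivative U' (at (\<phi> x)) (?D h))) (at x)"
      by (rule has_derivative_compose[OF has_derivative_frechet[OF twice_differentiable_atD(2)[OF \<phi>]]
            has_derivative_frechet[OF U']])
    ultimately show ?thesis
      by (rule has_derivative_unique[THEN fun_cong])
  qed
  have relx: "?D (V x) = V' (\<phi> x)" "?D (W x) = W' (\<phi> x)"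
    using relV relW by (auto dest: eventually_nhds_x_imp_x)
  have sym: "?H (V x) (W x) = ?H (W x) (V x)"
    by (rule second_derivative_symmetric[OF \<phi>])
  show ?thesis
    unfolding relx[symmetric] deriv[OF V V' relV, symmetric] deriv[OF W W' relW, symmetric]
    by (simp add: sym linear_diff[OF eventually_nhds_x_imp_x[OF lin]])
qed

section \<open>Twice differentiable maps of a manifold in charts\<close>

definition chart_rep ::
  "('m, 'e::real_normed_vector) chart \<Rightarrow> ('m, 'e) chart \<Rightarrow> ('m \<Rightarrow> 'm) \<Rightarrow> 'e \<Rightarrow> 'e" where
  "chart_rep c d h = coord d \<circ> h \<circ> chart_inv c"

definition chart_deriv ::
  "('m, 'e::real_normed_vector) chart \<Rightarrow> ('m, 'e) chart \<Rightarrow> ('m \<Rightarrow> 'm) \<Rightarrow> 'm \<Rightarrow> 'e \<Rightarrow> 'e" where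
  "chart_deriv c d h p = frechet_derivative (chart_rep c d h) (at (coord c p))"

text \<open>
  The manifold counterpart of \<^const>\<open>twice_differentiable_at\<close>, required in all pairs of charts. Only
  two derivatives are recorded, since the bracket of vector fields and the symmetry of second
  derivatives see no more.
\<close>

definition twice_differentiable_map ::
  "'m topology \<Rightarrow> ('m, 'e::real_normed_vector) chart set \<Rightarrow> ('m \<Rightarrow> 'm) \<Rightarrow> bool" where
  "twice_differentiable_map X A h \<longleftrightarrow> continuous_map X X h \<and>
     (\<forall>c\<in>A. \<forall>d\<in>A. \<forall>p\<in>chart_dom c. h p \<in> chart_dom d \<longrightarrow>
        twice_differentiable_at (chart_rep c d h) (coord c p))"

context smooth_manifold
begin

lemma inj_on_coord: "c \<in> A \<Longrightarrow> inj_on (coord c) (chart_dom c)"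
  using charts[of c] homeomorphic_imp_injective_map openin_subset
  unfolding is_chart_def by (metis topspace_subtopology_subset)

lemma chart_inv_coord: "c \<in> A \<Longrightarrow> p \<in> chart_dom c \<Longrightarrow> chart_inv c (coord c p) = p"
  unfolding chart_inv_def by (simp add: inj_on_coord)

lemma chart_dom_subset: "c \<in> A \<Longrightarrow> chart_dom c \<subseteq> topspace X"
  using charts[of c] openin_subset unfolding is_chart_def by blast

lemma open_coord_image:
  assumes "c \<in> A" and "openin X U"
  shows "open (coord c ` (U \<inter> chart_dom c))"
proof -
  let ?Y = "subtopology X (chart_dom c)"
  have c: "openin X (chart_dom c)" "open (coord c ` chart_dom c)"
    "homeomorphic_map ?Y (top_of_set (coord c ` chart_dom c)) (coord c)"
    using charts[OF assms(1)] unfolding is_chart_def by auto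
  have "openin ?Y (U \<inter> chart_dom c)"
    using assms(2) by (rule openin_subtopology_Int)
  then have "openin (top_of_set (coord c ` chart_dom c)) (coord c ` (U \<inter> chart_dom c))"
    using homeomorphic_map_openness_eq[OF c(3)] by blast
  then show ?thesis
    by (rule openin_open_trans[OF _ c(2)])
qed

lemma eventually_chart_inv:
  assumes "c \<in> A" and "openin X U" and "p \<in> U" and "p \<in> chart_dom c"
  shows "\<forall>\<^sub>F x in nhds (coord c p).
    chart_inv c x \<in> U \<and> chart_inv c x \<in> chart_dom c \<and> coord c (chart_inv c x) = x"
proof -
  have "\<forall>\<^sub>F x in nhds (coord c p). x \<in> coord c ` (U \<inter> chart_dom c)"
    using open_coord_image[OF assms(1,2)] assms(3,4) by (intro eventually_nhds_in_open) auto
  then show ?thesis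
    by eventually_elim (auto simp: chart_inv_coord[OF assms(1)])
qed

lemma openin_chart_dom: "c \<in> A \<Longrightarrow> openin X (chart_dom c)"
  using charts[of c] unfolding is_chart_def by blast

lemma chart_at: "p \<in> topspace X \<Longrightarrow> chart_at A p \<in> A \<and> p \<in> chart_dom (chart_at A p)"
  unfolding chart_at_def cover[symmetric] by (rule someI_ex) auto

lemma eventually_image_in_chart:
  assumes "continuous_map X X h" and "c \<in> A" and "d \<in> A" and "p \<in> chart_dom c" and "h p \<in> chart_dom d"
  shows "\<forall>\<^sub>F x in nhds (coord c p). h (chart_inv c x) \<in> chart_dom d \<and>
    chart_inv c x \<in> chart_dom c \<and> coord c (chart_inv c x) = x"
proof -
  have "openin X {q \<in> topspace X. h q \<in> chart_dom d}"
    using assms(1) openin_chart_dom[OF assms(3)] by (rule openin_continuous_map_preimage)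
  moreover have "p \<in> {q \<in> topspace X. h q \<in> chart_dom d}"
    using assms(4,5) chart_dom_subset[OF assms(2)] by blast
  ultimately have "\<forall>\<^sub>F x in nhds (coord c p). chart_inv c x \<in> {q \<in> topspace X. h q \<in> chart_dom d} \<and>
      chart_inv c x \<in> chart_dom c \<and> coord c (chart_inv c x) = x"
    using eventually_chart_inv[OF assms(2) _ _ assms(4)] by blast
  then show ?thesis by eventually_elim simp
qed

lemma twice_differentiable_mapD:
  assumes "twice_differentiable_map X A h"
  shows "continuous_map X X h"
    and "\<lbrakk>c \<in> A; d \<in> A; p \<in> chart_dom c; h p \<in> chart_dom d\<rbrakk> \<Longrightarrow>
      twice_differentiable_at (chart_rep c d h) (coord c p)"
  using assms unfolding twice_differentiable_map_def by blast+

lemma twice_differentiable_map_id: "twice_differentiable_map X A (\<lambda>p. p)"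
  unfolding twice_differentiable_map_def
proof (intro conjI ballI impI)
  fix c d p assume c: "c \<in> A" "d \<in> A" "p \<in> chart_dom c" "p \<in> chart_dom d"
  have "open (coord c ` (chart_dom d \<inter> chart_dom c))"
    using c by (intro open_coord_image openin_chart_dom)
  then have "twice_differentiable_at (coord d \<circ> chart_inv c) (coord c p)"
    using compatible[OF c(1,2)] c
    by (intro smooth_on_imp_twice_differentiable_at) (auto simp: Int_commute)
  then show "twice_differentiable_at (chart_rep c d (\<lambda>p. p)) (coord c p)"
    by (simp add: chart_rep_def o_def)
qed simp

text \<open>
  The two sides agree only near coord c p: inserting the intermediate chart e is legitimate as long
  as h maps into the domain of e, which continuity of h guarantees near p.
\<close>

lemma chart_rep_compose:
  assumes h: "continuous_map X X h" and c: "c \<in> A" "e \<in> A" "p \<in> chart_dom c" "h p \<in> chart_dom e"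
  shows "\<forall>\<^sub>F x in nhds (coord c p). chart_rep c d (k \<circ> h) x = (chart_rep e d k \<circ> chart_rep c e h) x"
  using eventually_image_in_chart[OF h c]
  by eventually_elim (simp add: chart_rep_def chart_inv_coord[OF c(2)])

lemma chart_rep_coord:
  "\<lbrakk>c \<in> A; p \<in> chart_dom c\<rbrakk> \<Longrightarrow> chart_rep c d h (coord c p) = coord d (h p)"
  by (simp add: chart_rep_def chart_inv_coord)

lemma twice_differentiable_map_compose:
  assumes h: "twice_differentiable_map X A h" and k: "twice_differentiable_map X A k"
  shows "twice_differentiable_map X A (k \<circ> h)"
  unfolding twice_differentiable_map_def
proof (intro conjI ballI impI)
  show "continuous_map X X (k \<circ> h)"
    using continuous_map_compose twice_differentiable_mapD(1)[OF h] twice_differentiable_mapD(1)[OF k] .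
next
  fix c d p assume c: "c \<in> A" "d \<in> A" "p \<in> chart_dom c" "(k \<circ> h) p \<in> chart_dom d"
  have "h p \<in> topspace X"
    using twice_differentiable_mapD(1)[OF h] c(1,3) chart_dom_subset continuous_map_image_subset_topspace by blast
  then obtain e where e: "e \<in> A" "h p \<in> chart_dom e" using chart_at by blast
  have "twice_differentiable_at (chart_rep e d k \<circ> chart_rep c e h) (coord c p)"
    using c e by (intro twice_differentiable_at_compose[OF finite_dimensional])
      (simp_all add: twice_differentiable_mapD[OF h] twice_differentiable_mapD[OF k] chart_rep_coord)
  then show "twice_differentiable_at (chart_rep c d (k \<circ> h)) (coord c p)"
    using twice_differentiable_at_eventually_cong[OF
        chart_rep_compose[OF twice_differentiable_mapD(1)[OF h] c(1) e(1) c(3) e(2)]]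
    by blast
qed

text \<open>
  The chain rule for a composite, with an arbitrary intermediate chart e. For h the identity or k the
  identity it also expresses the change of charts, which is how the preferred charts that enter
  the definition of the tangent map are eliminated.
\<close>

lemma chart_deriv_compose:
  assumes h: "twice_differentiable_map X A h" and k: "twice_differentiable_map X A k"
    and c: "c \<in> A" "d \<in> A" "e \<in> A" "p \<in> chart_dom c" "h p \<in> chart_dom e" "k (h p) \<in> chart_dom d"
  shows "chart_deriv c d (\<lambda>q. k (h q)) p v = chart_deriv e d k (h p) (chart_deriv c e h p v)"
proof -
  have "frechet_derivative (chart_rep c d (k \<circ> h)) (at (coord c p))
      = frechet_derivative (chart_rep e d k \<circ> chart_rep c e h) (at (coord c p))"
    using chart_rep_compose[OF twice_differentiable_mapD(1)[OF h] c(1,3,4,5)]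
    by (rule frechet_derivative_eventually_cong)
  also have "\<dots> = frechet_derivative (chart_rep e d k) (at (chart_rep c e h (coord c p)))
      \<circ> frechet_derivative (chart_rep c e h) (at (coord c p))"
    using c by (intro frechet_derivative_compose twice_differentiable_atD(2))
      (simp_all add: twice_differentiable_mapD[OF h] twice_differentiable_mapD[OF k] chart_rep_coord)
  finally show ?thesis
    using c by (simp add: chart_deriv_def chart_rep_coord o_def)
qed

lemma chart_deriv_cong:
  assumes "\<And>q. q \<in> topspace X \<Longrightarrow> h q = k q" and "c \<in> A" and "p \<in> chart_dom c"
  shows "chart_deriv c d h p = chart_deriv c d k p"
  unfolding chart_deriv_def
proof (rule frechet_derivative_eventually_cong)
  have "p \<in> topspace X" using assms chart_dom_subset by blast
  from eventually_chart_inv[OF assms(2) openin_topspace this assms(3)]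
  show "\<forall>\<^sub>F x in nhds (coord c p). chart_rep c d h x = chart_rep c d k x"
    by eventually_elim (simp add: chart_rep_def assms(1))
qed

end

section \<open>Translations, left-invariant fields and homomorphisms of Lie groups\<close>

context lie_group
begin

lemma one_in_topspace: "\<one> \<in> topspace X"
  by (simp add: topspace_eq)

text \<open>
  Smoothness of the multiplication is available on the image, under a product chart, of the pairs
  whose product lies in the domain of c. This image is open because the multiplication is
  continuous, so the coordinate expression is smooth near the given pair.
\<close>

lemma twice_differentiable_mult_in_charts:
  assumes "a \<in> A" "b \<in> A" "c \<in> A" and p: "p \<in> chart_dom a" and q: "q \<in> chart_dom b"
    and pq: "p \<otimes> q \<in> chart_dom c"
  shows "twice_differentiable_at (\<lambda>(x, y). coord c (chart_inv a x \<otimes> chart_inv b y))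
    (coord a p, coord b q)"
proof -
  let ?ab = "(chart_dom a \<times> chart_dom b, map_prod (coord a) (coord b))"
  let ?mult = "\<lambda>(g, h). g \<otimes> h"
  let ?D = "{z \<in> chart_dom a \<times> chart_dom b. ?mult z \<in> chart_dom c}"
  let ?S = "map_prod (coord a) (coord b) ` ?D"
  let ?m = "coord c \<circ> ?mult \<circ> chart_inv ?ab"
  have "?ab \<in> prod_atlas A A" using assms unfolding prod_atlas_def by blast
  then have smooth: "smooth_on ?S ?m"
    using smooth_mult \<open>c \<in> A\<close> unfolding smooth_map_def by fastforce
  have cont: "continuous_map (prod_topology X X) X ?mult"
    using smooth_mult unfolding smooth_map_def by blast
  have inv: "chart_inv ?ab (coord a g, coord b h) = (g, h)"
    if "g \<in> chart_dom a" "h \<in> chart_dom b" for g h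
  proof -
    have "inj_on (map_prod (coord a) (coord b)) (chart_dom a \<times> chart_dom b)"
      using inj_on_coord assms by (intro map_prod_inj_on)
    from inv_into_f_f[OF this, of "(g, h)"] that show ?thesis by (simp add: chart_inv_def)
  qed
  have "open ?S"
    unfolding open_prod_def
  proof
    fix z assume "z \<in> ?S"
    then obtain g h where gh: "z = (coord a g, coord b h)" "g \<in> chart_dom a" "h \<in> chart_dom b"
      "g \<otimes> h \<in> chart_dom c" by auto
    let ?W = "{w \<in> topspace (prod_topology X X). ?mult w \<in> chart_dom c}"
    have "openin (prod_topology X X) ?W"
      using cont openin_chart_dom[OF \<open>c \<in> A\<close>] by (rule openin_continuous_map_preimage)
    moreover have "(g, h) \<in> ?W"
      using gh chart_dom_subset[OF \<open>a \<in> A\<close>] chart_dom_subset[OF \<open>b \<in> A\<close>] by auto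
    ultimately obtain U V where UV: "openin X U" "openin X V" "g \<in> U" "h \<in> V" "U \<times> V \<subseteq> ?W"
      unfolding openin_prod_topology_alt by meson
    have "open (coord a ` (U \<inter> chart_dom a))" "open (coord b ` (V \<inter> chart_dom b))"
      using UV assms by (auto intro: open_coord_image)
    moreover have "coord a ` (U \<inter> chart_dom a) \<times> coord b ` (V \<inter> chart_dom b) \<subseteq> ?S"
      using UV(5) by force
    moreover have "z \<in> coord a ` (U \<inter> chart_dom a) \<times> coord b ` (V \<inter> chart_dom b)"
      using gh UV by auto
    ultimately show "\<exists>P Q. open P \<and> open Q \<and> z \<in> P \<times> Q \<and> P \<times> Q \<subseteq> ?S" by blast
  qed
  moreover have mem: "(coord a p, coord b q) \<in> ?S" using p q pq by force
  ultimately have "twice_differentiable_at ?m (coord a p, coord b q)"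
    using smooth by (intro smooth_on_imp_twice_differentiable_at)
  moreover have "\<forall>\<^sub>F z in nhds (coord a p, coord b q).
      ?m z = (\<lambda>(x, y). coord c (chart_inv a x \<otimes> chart_inv b y)) z"
    using eventually_nhds_in_open[OF \<open>open ?S\<close> mem]
    by eventually_elim (auto simp: inv chart_inv_coord assms)
  ultimately show ?thesis
    using twice_differentiable_at_eventually_cong by blast
qed

text \<open>
  A translation is the multiplication restricted to a slice, hence in coordinates the composite of
  the multiplication with an affine map.
\<close>

lemma twice_differentiable_left_translation:
  assumes g: "g \<in> carrier G"
  shows "twice_differentiable_map X A (\<lambda>h. g \<otimes> h)"
  unfolding twice_differentiable_map_def
proof (intro conjI ballI impI)
  have "continuous_map X (prod_topology X X) (\<lambda>h. (g, h))"
    using g by (intro continuous_map_pairedI) (simp_all add: topspace_eq)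
  from continuous_map_compose[OF this, of X "\<lambda>(g, h). g \<otimes> h"]
  show "continuous_map X X (\<lambda>h. g \<otimes> h)"
    using smooth_mult unfolding smooth_map_def by (simp add: o_def)
next
  fix c d p assume c: "c \<in> A" "d \<in> A" "p \<in> chart_dom c" "g \<otimes> p \<in> chart_dom d"
  obtain a where a: "a \<in> A" "g \<in> chart_dom a" using chart_at g topspace_eq by blast
  let ?m = "\<lambda>(x, y). coord d (chart_inv a x \<otimes> chart_inv c y)"
  have "twice_differentiable_at (?m \<circ> (\<lambda>y. (coord a g, y))) (coord c p)"
  proof (rule twice_differentiable_at_compose)
    show "twice_differentiable_at (Pair (coord a g)) (coord c p)"
      by (rule twice_differentiable_at_affine) (auto intro!: derivative_eq_intros)
  qed (use a c in \<open>auto intro!: twice_differentiable_mult_in_charts finite_dimensional_space_prod finite_dimensional\<close>)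
  then show "twice_differentiable_at (chart_rep c d (\<lambda>h. g \<otimes> h)) (coord c p)"
    using a by (simp add: chart_rep_def o_def chart_inv_coord)
qed

lemma twice_differentiable_right_translation:
  assumes g: "g \<in> carrier G"
  shows "twice_differentiable_map X A (\<lambda>h. h \<otimes> g)"
  unfolding twice_differentiable_map_def
proof (intro conjI ballI impI)
  have "continuous_map X (prod_topology X X) (\<lambda>h. (h, g))"
    using g by (intro continuous_map_pairedI) (simp_all add: topspace_eq)
  from continuous_map_compose[OF this, of X "\<lambda>(g, h). g \<otimes> h"]
  show "continuous_map X X (\<lambda>h. h \<otimes> g)"
    using smooth_mult unfolding smooth_map_def by (simp add: o_def)
next
  fix c d p assume c: "c \<in> A" "d \<in> A" "p \<in> chart_dom c" "p \<otimes> g \<in> chart_dom d"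
  obtain a where a: "a \<in> A" "g \<in> chart_dom a" using chart_at g topspace_eq by blast
  let ?m = "\<lambda>(x, y). coord d (chart_inv c x \<otimes> chart_inv a y)"
  have "twice_differentiable_at (?m \<circ> (\<lambda>y. (y, coord a g))) (coord c p)"
  proof (rule twice_differentiable_at_compose)
    show "twice_differentiable_at (\<lambda>y. (y, coord a g)) (coord c p)"
      by (rule twice_differentiable_at_affine) (auto intro!: derivative_eq_intros)
  qed (use a c in \<open>auto intro!: twice_differentiable_mult_in_charts finite_dimensional_space_prod finite_dimensional\<close>)
  then show "twice_differentiable_at (chart_rep c d (\<lambda>h. h \<otimes> g)) (coord c p)"
    using a by (simp add: chart_rep_def o_def chart_inv_coord)
qed

text \<open>
  The definition of the left-hand side passes from the chart at the identity to the preferred chart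
  at q and back; the two changes of chart cancel by the chain rule. What remains involves the single
  chart c, so its dependence on q can be differentiated.
\<close>

lemma left_invariant_field_in_chart:
  assumes c: "c = chart_at A \<one>" and q: "q \<in> chart_dom c"
  shows "field_in_chart A c (left_invariant_field G A \<xi>) (coord c q)
    = chart_deriv c c (\<lambda>h. q \<otimes> h) \<one> \<xi>"
proof -
  have cA: "c \<in> A" "\<one> \<in> chart_dom c" using chart_at[OF one_in_topspace] c by auto
  have qX: "q \<in> topspace X" using chart_dom_subset cA(1) q by blast
  then have qG: "q \<in> carrier G" by (simp add: topspace_eq)
  let ?d = "chart_at A q"
  have d: "?d \<in> A" "q \<in> chart_dom ?d" using chart_at[OF qX] by auto
  have "field_in_chart A c (left_invariant_field G A \<xi>) (coord c q)
      = chart_deriv ?d c (\<lambda>p. p) q (chart_deriv c ?d (\<lambda>h. q \<otimes> h) \<one> \<xi>)"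
    using qG by (simp add: field_in_chart_def left_invariant_field_def tangent_map_def chart_deriv_def
        chart_rep_def chart_inv_coord[OF cA(1) q] o_def flip: c)
  also have "\<dots> = chart_deriv c c (\<lambda>h. q \<otimes> h) \<one> \<xi>"
    using chart_deriv_compose[OF twice_differentiable_left_translation[OF qG]
        twice_differentiable_map_id, of c c ?d \<one> \<xi>] cA d q qG by simp
  finally show ?thesis .
qed

text \<open>
  In the chart c the field is the partial derivative of the multiplication m in its second argument
  at the identity, along \<xi>, and a partial derivative of a smooth map is differentiable in the
  remaining argument.
\<close>

lemma left_invariant_field_differentiable:
  assumes c: "c = chart_at A \<one>"
  shows "field_in_chart A c (left_invariant_field G A \<xi>) differentiable (at (coord c \<one>))"
proof -
  have cA: "c \<in> A" "\<one> \<in> chart_dom c" using chart_at[OF one_in_topspace] c by auto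
  let ?x0 = "coord c \<one>"
  define m where "m = (\<lambda>(x, y). coord c (chart_inv c x \<otimes> chart_inv c y))"
  have m: "twice_differentiable_at m (?x0, ?x0)"
    unfolding m_def using cA by (intro twice_differentiable_mult_in_charts) simp_all
  have "isCont (\<lambda>x. (x, ?x0)) ?x0" by (intro continuous_intros)
  then have m_diff: "\<forall>\<^sub>F x in nhds ?x0. m differentiable (at (x, ?x0))"
    by (rule eventually_nhds_compose_continuous) (rule twice_differentiable_atD(1)[OF m])
  have "((\<lambda>x. (x, ?x0)) has_derivative (\<lambda>h. (h, 0))) (at ?x0)"
    by (auto intro!: derivative_eq_intros)
  from has_derivative_compose[OF this has_derivative_frechet[OF twice_differentiable_atD(3)[OF m, of "(0, \<xi>)"]]]
  have "(\<lambda>x. frechet_derivative m (at (x, ?x0)) (0, \<xi>)) differentiable (at ?x0)"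
    by (rule differentiableI)
  moreover have "\<forall>\<^sub>F x in nhds ?x0. frechet_derivative m (at (x, ?x0)) (0, \<xi>)
      = field_in_chart A c (left_invariant_field G A \<xi>) x"
    using m_diff eventually_chart_inv[OF cA(1) openin_topspace one_in_topspace cA(2)]
  proof eventually_elim
    case (elim x)
    have "((\<lambda>y. (x, y)) has_derivative (\<lambda>h. (0, h))) (at ?x0)"
      by (auto intro!: derivative_eq_intros)
    from has_derivative_compose[OF this has_derivative_frechet[OF elim(1)]]
    have "frechet_derivative (\<lambda>y. m (x, y)) (at ?x0) = (\<lambda>h. frechet_derivative m (at (x, ?x0)) (0, h))"
      by (rule frechet_derivative_eqI)
    moreover have "(\<lambda>y. m (x, y)) = chart_rep c c (\<lambda>h. chart_inv c x \<otimes> h)"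
      by (simp add: m_def chart_rep_def o_def)
    ultimately have "frechet_derivative m (at (x, ?x0)) (0, \<xi>)
        = chart_deriv c c (\<lambda>h. chart_inv c x \<otimes> h) \<one> \<xi>"
      unfolding chart_deriv_def by metis
    then show ?case
      using left_invariant_field_in_chart[OF c, of "chart_inv c x" \<xi>] elim(2) by simp
  qed
  ultimately show ?thesis
    by (rule differentiable_eventually_cong[THEN iffD1, rotated])
qed

text \<open>
  A homomorphism h intertwines left translation by q with left translation by h q. The
  relation between the fields is the derivative of this equation at the identity element.
\<close>

lemma left_invariant_fields_related:
  assumes hom: "h \<in> hom G G" and h: "twice_differentiable_map X A h" and c: "c = chart_at A \<one>"
  shows "\<forall>\<^sub>F x in nhds (coord c \<one>).
    frechet_derivative (chart_rep c c h) (at x) (field_in_chart A c (left_invariant_field G A \<xi>) x)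
    = field_in_chart A c (left_invariant_field G A (chart_deriv c c h \<one> \<xi>)) (chart_rep c c h x)"
proof -
  have cA: "c \<in> A" "\<one> \<in> chart_dom c" using chart_at[OF one_in_topspace] c by auto
  have h1: "h \<one> = \<one>" using hom by (intro hom_one) (auto simp: is_group)
  have "\<forall>\<^sub>F x in nhds (coord c \<one>). h (chart_inv c x) \<in> chart_dom c \<and>
      chart_inv c x \<in> chart_dom c \<and> coord c (chart_inv c x) = x"
    using cA h1 by (intro eventually_image_in_chart twice_differentiable_mapD(1)[OF h]) auto
  then show ?thesis
  proof eventually_elim
    case (elim x)
    define q where "q = chart_inv c x"
    have q: "q \<in> chart_dom c" "h q \<in> chart_dom c" "coord c q = x"
      using elim by (auto simp: q_def)
    have qG: "q \<in> carrier G" and hqG: "h q \<in> carrier G"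
      using q chart_dom_subset[OF cA(1)] by (auto simp: topspace_eq)
    note L = twice_differentiable_left_translation
    have "frechet_derivative (chart_rep c c h) (at x) (field_in_chart A c (left_invariant_field G A \<xi>) x)
        = chart_deriv c c h q (chart_deriv c c (\<lambda>g. q \<otimes> g) \<one> \<xi>)"
      using left_invariant_field_in_chart[OF c q(1), of \<xi>] q(3) by (simp add: chart_deriv_def)
    also have "\<dots> = chart_deriv c c (\<lambda>g. h (q \<otimes> g)) \<one> \<xi>"
      using chart_deriv_compose[OF L[OF qG] h, of c c c \<one> \<xi>] cA q qG by simp
    also have "\<dots> = chart_deriv c c (\<lambda>g. h q \<otimes> h g) \<one> \<xi>"
      using hom_mult[OF hom qG] cA by (subst chart_deriv_cong) (auto simp: topspace_eq)
    also have "\<dots> = chart_deriv c c (\<lambda>g. h q \<otimes> g) \<one> (chart_deriv c c h \<one> \<xi>)"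
      using chart_deriv_compose[OF h L[OF hqG], of c c c \<one> \<xi>] cA q hqG h1 by simp
    also have "\<dots> = field_in_chart A c (left_invariant_field G A (chart_deriv c c h \<one> \<xi>))
        (chart_rep c c h x)"
      using left_invariant_field_in_chart[OF c q(2)] by (simp add: chart_rep_def q_def)
    finally show ?case .
  qed
qed

text \<open>
  Fields related by h have commutators related by h, and h fixes the identity element, where both
  brackets are evaluated.
\<close>

lemma lie_bracket_tangent_map_hom:
  assumes hom: "h \<in> hom G G" and h: "twice_differentiable_map X A h"
  shows "tangent_map A A h \<one> (lie_bracket G A \<xi> \<eta>)
    = lie_bracket G A (tangent_map A A h \<one> \<xi>) (tangent_map A A h \<one> \<eta>)"
proof -
  define c where "c = chart_at A \<one>"
  have cA: "c \<in> A" "\<one> \<in> chart_dom c" using chart_at[OF one_in_topspace] c_def by auto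
  have h1: "h \<one> = \<one>" using hom by (intro hom_one) (auto simp: is_group)
  have T: "tangent_map A A h \<one> = chart_deriv c c h \<one>"
    by (simp add: tangent_map_def chart_deriv_def chart_rep_def h1 c_def)
  have fix1: "chart_rep c c h (coord c \<one>) = coord c \<one>"
    using cA h1 by (simp add: chart_rep_coord)
  note rel = left_invariant_fields_related[OF hom h c_def]
  note diff = left_invariant_field_differentiable[OF c_def]
  have "twice_differentiable_at (chart_rep c c h) (coord c \<one>)"
    using cA h1 by (intro twice_differentiable_mapD(2)[OF h]) auto
  from commutator_of_related_fields[OF finite_dimensional this diff diff _ _ rel rel]
  show ?thesis
    unfolding T lie_bracket_def field_bracket_def Let_def c_def[symmetric] fix1
    by (simp add: chart_deriv_def fix1 diff)
qed

lemma conjugation_hom: "f \<in> carrier G \<Longrightarrow> (\<lambda>g. f \<otimes> g \<otimes> inv f) \<in> hom G G"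
  by (intro homI) (simp_all add: m_assoc inv_solve_left)

lemma twice_differentiable_conjugation:
  assumes "f \<in> carrier G"
  shows "twice_differentiable_map X A (\<lambda>g. f \<otimes> g \<otimes> inv f)"
  using twice_differentiable_map_compose[OF twice_differentiable_left_translation[OF assms]
      twice_differentiable_right_translation[OF inv_closed[OF assms]]]
  by (simp add: o_def)

lemma Ad_lie_bracket:
  assumes "f \<in> carrier G"
  shows "Ad G A f (lie_bracket G A \<xi> \<eta>) = lie_bracket G A (Ad G A f \<xi>) (Ad G A f \<eta>)"
  unfolding Ad_def
  using assms by (intro lie_bracket_tangent_map_hom conjugation_hom twice_differentiable_conjugation)

lemma bounded_linear_Ad:
  assumes "f \<in> carrier G"
  shows "bounded_linear (Ad G A f)"
proof -
  have c: "chart_at A \<one> \<in> A" "\<one> \<in> chart_dom (chart_at A \<one>)" using chart_at[OF one_in_topspace] by auto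
  have "chart_rep (chart_at A \<one>) (chart_at A \<one>) (\<lambda>g. f \<otimes> g \<otimes> inv f) differentiable
      (at (coord (chart_at A \<one>) \<one>))"
    using c assms
    by (intro twice_differentiable_atD(2) twice_differentiable_mapD(2)[OF twice_differentiable_conjugation]) auto
  from has_derivative_bounded_linear[OF has_derivative_frechet[OF this]]
  show ?thesis
    using assms by (simp add: Ad_def tangent_map_def chart_rep_def)
qed

end

section \<open>Functional derivatives and the coadjoint action\<close>

text \<open>
  At most one vector represents a given functional on the dual, since coordinate functionals separate
  points; this determines the value of the definite description.
\<close>

lemma functional_derivative_eqI:
  fixes F :: "('e::real_normed_vector \<Rightarrow>\<^sub>L real) \<Rightarrow> real"
  assumes fd: "finite_dimensional_space TYPE('e)"
    and \<xi>: "\<And>\<nu>. frechet_derivative F (at \<mu>) \<nu> = blinfun_apply \<nu> \<xi>"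
  shows "functional_derivative F \<mu> = \<xi>"
  unfolding functional_derivative_def
proof (rule the_equality)
  fix \<zeta> assume \<zeta>: "\<forall>\<nu>. frechet_derivative F (at \<mu>) \<nu> = blinfun_apply \<nu> \<zeta>"
  obtain B :: "'e set" and c :: "'e \<Rightarrow> ('e \<Rightarrow>\<^sub>L real)"
    where c: "finite B" "\<And>x. (\<Sum>b\<in>B. blinfun_apply (c b) x *\<^sub>R b) = x"
    using finite_dimensional_coordinates[OF fd] by metis
  have "blinfun_apply \<nu> \<zeta> = blinfun_apply \<nu> \<xi>" for \<nu> :: "'e \<Rightarrow>\<^sub>L real"
    using \<zeta> \<xi>[of \<nu>] by simp
  then have "(\<Sum>b\<in>B. blinfun_apply (c b) \<zeta> *\<^sub>R b) = (\<Sum>b\<in>B. blinfun_apply (c b) \<xi> *\<^sub>R b)"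
    by (simp only:)
  then show "\<zeta> = \<xi>" by (simp only: c(2))
qed (use \<xi> in simp)

text \<open>
  The surjectivity of the canonical map of a finite-dimensional space into its bidual: with \<nu>
  written as a combination of coordinate functionals c b, a linear functional D takes on it the value
  \<nu> (\<Sum>b. D (c b) b).
\<close>

lemma frechet_derivative_functional_derivative:
  fixes F :: "('e::real_normed_vector \<Rightarrow>\<^sub>L real) \<Rightarrow> real"
  assumes fd: "finite_dimensional_space TYPE('e)" and F: "F differentiable (at \<mu>)"
  shows "frechet_derivative F (at \<mu>) \<nu> = blinfun_apply \<nu> (functional_derivative F \<mu>)"
proof -
  let ?D = "frechet_derivative F (at \<mu>)"
  have lin: "linear ?D" using F by (rule linear_frechet_derivative)
  obtain B :: "'e set" and c :: "'e \<Rightarrow> ('e \<Rightarrow>\<^sub>L real)"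
    where c: "finite B" "\<And>x. (\<Sum>b\<in>B. blinfun_apply (c b) x *\<^sub>R b) = x"
    using finite_dimensional_coordinates[OF fd] by metis
  define \<xi> where "\<xi> = (\<Sum>b\<in>B. ?D (c b) *\<^sub>R b)"
  have D: "?D \<nu> = blinfun_apply \<nu> \<xi>" for \<nu>
  proof -
    have "\<nu> = (\<Sum>b\<in>B. blinfun_apply \<nu> b *\<^sub>R c b)"
    proof (rule blinfun_eqI)
      fix x
      have "blinfun_apply \<nu> x = blinfun_apply \<nu> (\<Sum>b\<in>B. blinfun_apply (c b) x *\<^sub>R b)"
        by (simp only: c(2))
      then show "blinfun_apply \<nu> x = blinfun_apply (\<Sum>b\<in>B. blinfun_apply \<nu> b *\<^sub>R c b) x"
        by (simp add: blinfun.sum_right blinfun.scaleR_right blinfun.sum_left blinfun.scaleR_left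
            mult.commute)
    qed
    then have "?D \<nu> = ?D (\<Sum>b\<in>B. blinfun_apply \<nu> b *\<^sub>R c b)" by simp
    then show ?thesis
      by (simp add: \<xi>_def linear_sum[OF lin] linear_scale[OF lin] blinfun.sum_right
          blinfun.scaleR_right mult.commute)
  qed
  then show ?thesis using functional_derivative_eqI[OF fd D] by simp
qed

lemma times_differentiable_on_const: "times_differentiable_on n S (\<lambda>x. k)"
  by (induction n arbitrary: k) simp_all

lemma bounded_linear_imp_smooth_on:
  assumes "bounded_linear f"
  shows "smooth_on S f"
  unfolding smooth_on_def
proof
  fix n
  have "(f has_derivative f) (at x)" for x
    using bounded_linear.has_derivative[OF assms has_derivative_ident] .
  then have "f differentiable (at x)" "frechet_derivative f (at x) = f" for x
    by (auto intro: differentiableI frechet_derivative_eqI)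
  moreover have "continuous_on S f"
    using linear_continuous_on[OF assms] .
  ultimately show "times_differentiable_on n S f"
    by (cases n) (simp_all add: times_differentiable_on_const)
qed

lemma Ad_dual_apply:
  "bounded_linear (Ad G A f) \<Longrightarrow> blinfun_apply (Ad_dual G A f \<mu>) \<xi> = blinfun_apply \<mu> (Ad G A f \<xi>)"
  unfolding Ad_dual_def
  by (simp add: bounded_linear_Blinfun_apply bounded_linear_compose[OF blinfun.bounded_linear_right])

lemma bounded_linear_Ad_dual:
  assumes "bounded_linear (Ad G A f)"
  shows "bounded_linear (Ad_dual G A f)"
proof -
  have "Ad_dual G A f = (\<lambda>\<mu>. \<mu> o\<^sub>L Blinfun (Ad G A f))"
    by (rule ext, rule blinfun_eqI) (simp add: Ad_dual_apply assms bounded_linear_Blinfun_apply)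
  then show ?thesis
    by (simp add: bounded_linear_intros)
qed

text \<open>
  By the chain rule, composing with a linear map applies the transpose of that map to the functional
  derivative, and the transpose of \<open>Ad_dual\<close> is \<open>Ad\<close>.
\<close>

lemma functional_derivative_compose_Ad_dual:
  fixes A :: "('g, 'e::real_normed_vector) chart set"
  assumes fd: "finite_dimensional_space TYPE('e)" and Ad: "bounded_linear (Ad G A f)"
    and F: "F differentiable (at (Ad_dual G A f \<mu>))"
  shows "functional_derivative (F \<circ> Ad_dual G A f) \<mu>
    = Ad G A f (functional_derivative F (Ad_dual G A f \<mu>))"
proof (rule functional_derivative_eqI[OF fd])
  fix \<nu>
  have "(Ad_dual G A f has_derivative Ad_dual G A f) (at \<mu>)"
    using bounded_linear.has_derivative[OF bounded_linear_Ad_dual[OF Ad] has_derivative_ident] .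
  from diff_chain_at[OF this has_derivative_frechet[OF F]]
  have "frechet_derivative (F \<circ> Ad_dual G A f) (at \<mu>) \<nu>
      = frechet_derivative F (at (Ad_dual G A f \<mu>)) (Ad_dual G A f \<nu>)"
    by (simp add: frechet_derivative_eqI)
  also have "\<dots> = blinfun_apply \<nu> (Ad G A f (functional_derivative F (Ad_dual G A f \<mu>)))"
    by (simp add: frechet_derivative_functional_derivative[OF fd F] Ad_dual_apply[OF Ad])
  finally show "frechet_derivative (F \<circ> Ad_dual G A f) (at \<mu>) \<nu>
      = blinfun_apply \<nu> (Ad G A f (functional_derivative F (Ad_dual G A f \<mu>)))" .
qed

text \<open>
  By the previous lemma the brackets at \<mu> of the composed functions are \<mu> evaluated at the Lie
  bracket of two images under \<open>Ad\<close>. Since \<open>Ad\<close> is a homomorphism of Lie algebras it can be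
  pulled out of the bracket and moved over to \<mu>, which gives the bracket at the transformed point.
\<close>

lemma (in lie_group) lie_poisson_map_Ad_dual:
  assumes f: "f \<in> carrier G"
  shows "lie_poisson_map G A (Ad_dual G A f)"
  unfolding lie_poisson_map_def
proof (intro conjI allI impI)
  note Ad = bounded_linear_Ad[OF f]
  show "smooth_on UNIV (Ad_dual G A f)"
    by (intro bounded_linear_imp_smooth_on bounded_linear_Ad_dual Ad)
  fix F H :: "('e \<Rightarrow>\<^sub>L real) \<Rightarrow> real"
  assume smooth: "smooth_on UNIV F" "smooth_on UNIV H"
  have diff: "F differentiable (at \<mu>)" "H differentiable (at \<mu>)" for \<mu>
    using smooth_on_imp_twice_differentiable_at[OF smooth(1)]
      smooth_on_imp_twice_differentiable_at[OF smooth(2)] by (auto intro: twice_differentiable_atD(2))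
  show "lie_poisson_bracket G A (F \<circ> Ad_dual G A f) (H \<circ> Ad_dual G A f)
      = lie_poisson_bracket G A F H \<circ> Ad_dual G A f"
    by (simp add: fun_eq_iff lie_poisson_bracket_def Ad_dual_apply[OF Ad] Ad_lie_bracket[OF f] diff
        functional_derivative_compose_Ad_dual[OF finite_dimensional Ad])
qed

theorem proposition3p1:
  fixes G :: "('g, 'x) monoid_scheme"
    and X :: "'g topology"
    and A :: "('g, 'e::real_normed_vector) chart set"
    and L :: "'g \<times> 'g \<Rightarrow> real"
    and l :: "'g \<Rightarrow> real"
    and N :: enat
    and f :: "nat \<Rightarrow> 'g"
  assumes "lie_group G X A"
    and "smooth_map (prod_topology X X) (prod_atlas A A) euclideanreal real_atlas L"
    and "\<And>g1 g2 h. \<lbrakk>g1 \<in> carrier G; g2 \<in> carrier G; h \<in> carrier G\<rbrakk> \<Longrightarrow>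
           L (g1 \<otimes>\<^bsub>G\<^esub> h, g2 \<otimes>\<^bsub>G\<^esub> h) = L (g1, g2)"
    and "\<And>g1 g2. \<lbrakk>g1 \<in> carrier G; g2 \<in> carrier G\<rbrakk> \<Longrightarrow>
           l (g1 \<otimes>\<^bsub>G\<^esub> m_inv G g2) = L (g1, g2)"
    and "dep_sequence G A l N f"
  shows "\<forall>k. enat k < N \<longrightarrow> lie_poisson_map G A (dlp_step G A f k)"
proof (intro allI impI)
  fix k assume "enat k < N"
  then have "f k \<in> carrier G" using assms(5) unfolding dep_sequence_def by blast
  moreover have "dlp_step G A f k = Ad_dual G A (f k)" by (simp add: fun_eq_iff dlp_step_def)
  ultimately show "lie_poisson_map G A (dlp_step G A f k)"
    using lie_group.lie_poisson_map_Ad_dual[OF assms(1)] by simp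
qed

end
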